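(* Let $(T,d)$ be a metric space and $m$ a Borel probability measure on $T$ with $\operatorname{supp}(m)=T$. Let $a,b\ge 0$, $\varphi\in\mathcal{G}_{a,b}$ and $R\ge 2$. Put $A=\frac{R^3}{(R-1)(R-2)}$ and $B=\frac{R^2}{R-1}$. Then there exists a probability measure $\nu$ on $T\times T$ such that for each bounded continuous function $f:T\to\mathbb{R}$ the inequality $$\left|f(t)-\int_T f(u)\,m(du)\right|\le aA\,\sigma(t)+bB\,\bar{\mathcal{S}}\int_{T\times T}\varphi\left(\frac{|f(u)-f(v)|}{d(u,v)}\right)\nu(du,dv)$$ holds for all $t\in T$.
   Context: $B(x,\varepsilon)=\{y\in T:d(x,y)\le\varepsilon\}$ is the closed ball and $D(T)=\sup\{d(s,t):s,t\in T\}$ the diameter of $T$ (possibly $+\infty$). For $a,b\ge0$, $\mathcal{G}_{a,b}$ is the class of all functions $\varphi:\mathbb{R}_+\to\mathbb{R}$ that are (strictly) increasing and continuous, satisfy $\varphi(0)=0$, and satisfy $x\le a+b\frac{\varphi(xy)}{\varphi(y)}$ for all $x\ge 0$, $y\ge\varphi^{-1}(1)$; it is understood that the inverse $\varphi^{-1}$ is defined on $[0,\infty)$. Define $\sigma(x)=\int_0^{D(T)}\varphi^{-1}\left(\frac{1}{m(B(x,\varepsilon))}\right)d\varepsilon\in[0,\infty]$ and $\bar{\mathcal{S}}=\int_T\sigma(u)\,m(du)\in[0,\infty]$. Conventions: $0/0=0$ (in particular the integrand equals $\varphi(0)=0$ on the diagonal $u=v$); for $R=2$, $A=+\infty$; and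 $0\cdot\infty=0$. *)

theory Defs
  imports "HOL-Probability.Probability"
begin

definition measure_support :: "'a::topological_space measure \<Rightarrow> 'a set" where
  "measure_support m = {x. \<forall>U. open U \<longrightarrow> x \<in> U \<longrightarrow> emeasure m U > 0}"

text \<open>The library's \<^const>\<open>diameter\<close> is real-valued and carries no information on unbounded
  sets, whereas the diameter needed here may be infinite.\<close>

definition ediam :: "'a::metric_space set \<Rightarrow> ennreal" where
  "ediam S = (SUP (s, t) \<in> S \<times> S. ennreal (dist s t))"

text \<open>Functions on the half-line are total functions on the reals of which only the values on
  \<open>{0..}\<close> matter; their inverse is taken on that half-line.\<close>

abbreviation half_inv :: "(real \<Rightarrow> real) \<Rightarrow> real \<Rightarrow> real" where
  "half_inv \<phi> \<equiv> the_inv_into {0..} \<phi>"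

text \<open>The condition \<open>\<phi> ` {0..} = {0..}\<close> says that the inverse is defined on all of \<open>{0..}\<close>.\<close>

definition growth_class :: "real \<Rightarrow> real \<Rightarrow> (real \<Rightarrow> real) set" where
  "growth_class a b = {\<phi>.
     strict_mono_on {0..} \<phi> \<and> continuous_on {0..} \<phi> \<and> \<phi> 0 = 0 \<and> \<phi> ` {0..} = {0..} \<and>
     (\<forall>x\<ge>0. \<forall>y\<ge>half_inv \<phi> 1. x \<le> a + b * (\<phi> (x * y) / \<phi> y))}"

definition maj_sigma :: "'a::metric_space measure \<Rightarrow> (real \<Rightarrow> real) \<Rightarrow> 'a \<Rightarrow> ennreal" where
  "maj_sigma m \<phi> x =
     (\<integral>\<^sup>+\<epsilon>\<in>{\<epsilon>. 0 < \<epsilon> \<and> ennreal \<epsilon> < ediam (UNIV :: 'a set)}.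
        ennreal (half_inv \<phi> (1 / measure m (cball x \<epsilon>))) \<partial>lborel)"

definition maj_S :: "'a::metric_space measure \<Rightarrow> (real \<Rightarrow> real) \<Rightarrow> ennreal" where
  "maj_S m \<phi> = (\<integral>\<^sup>+u. maj_sigma m \<phi> u \<partial>m)"

end

theory Submission
  imports Defs
begin

text \<open>
  Put \<open>c k = \<phi>\<^sup>-\<^sup>1(1) R\<^sup>k\<close> and let \<open>r k x\<close> be the smallest radius for which the closed ball around
  \<open>x\<close> has measure at least \<open>1 / \<phi> (c k)\<close>. Let \<open>S k\<close> average a function over that ball. As \<open>S 0\<close>
  integrates over all of \<open>T\<close> and \<open>S n f t\<close> tends to \<open>f t\<close>, the deviation of \<open>f t\<close> from its mean
  telescopes into the terms \<open>S n \<dots> S (k + 1) (f - S k f) t\<close>. The growth condition at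
  \<open>y = c (k + 1)\<close> bounds \<open>\<bar>f u - f v\<bar>\<close> by \<open>c (k + 1) r k u\<close> times
  \<open>a + b \<phi> (\<bar>f u - f v\<bar> / d (u, v)) / \<phi> (c (k + 1))\<close>. In the \<open>a\<close>-part the radii are 1-Lipschitz, so
  averaging them costs only a factor that the geometric growth of \<open>c k\<close> absorbs when \<open>R > 2\<close>. In the
  \<open>b\<close>-part the density of \<open>S (k + 1)\<close> is at most \<open>\<phi> (c (k + 1))\<close>, so it is bounded by an integral
  over \<open>T \<times> T\<close> that does not depend on \<open>t\<close>; \<open>\<nu>\<close> is the normalised sum of the weights that occur.
  Both parts are compared with \<open>\<sigma>\<close> through \<open>(\<Sum>k. c k * r k x) \<le> R / (R - 1) * \<sigma> x\<close>.
\<close>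

section \<open>Separability and the product Borel algebra\<close>

lemma measure_supportD: "x \<in> measure_support M \<Longrightarrow> open U \<Longrightarrow> x \<in> U \<Longrightarrow> 0 < emeasure M U"
  by (simp add: measure_support_def)

text \<open>By Zorn's lemma: a point at distance at least \<open>e\<close> from every member of a
  maximal separated set could be added to it. The disjunct \<open>x = s\<close> covers
  \<open>e \<le> 0\<close>, where no distance lies below \<open>e\<close>.\<close>

lemma maximal_separated_set:
  fixes e :: real
  obtains S :: "'a::metric_space set"
  where "\<And>x y. x \<in> S \<Longrightarrow> y \<in> S \<Longrightarrow> x \<noteq> y \<Longrightarrow> e \<le> dist x y"
    and "\<And>x. \<exists>s\<in>S. x = s \<or> dist x s < e"
proof -
  define Q where "Q = {S :: 'a set. \<forall>x\<in>S. \<forall>y\<in>S. x \<noteq> y \<longrightarrow> e \<le> dist x y}"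
  have "\<exists>S\<in>Q. \<forall>X\<in>Q. S \<subseteq> X \<longrightarrow> X = S"
  proof (rule subset_Zorn')
    fix C assume C: "subset.chain Q C"
    have "e \<le> dist x y" if "X \<in> C" "Y \<in> C" "x \<in> X" "y \<in> Y" "x \<noteq> y" for X Y x y
    proof -
      have "X \<subseteq> Y \<or> Y \<subseteq> X" "X \<in> Q" "Y \<in> Q"
        using C that unfolding subset.chain_def by auto
      then show ?thesis using that unfolding Q_def by blast
    qed
    then show "\<Union>C \<in> Q" unfolding Q_def by blast
  qed
  then obtain S where S: "S \<in> Q" and max: "\<And>X. X \<in> Q \<Longrightarrow> S \<subseteq> X \<Longrightarrow> X = S"
    by blast
  have "\<exists>s\<in>S. x = s \<or> dist x s < e" for x
  proof (rule ccontr)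
    assume *: "\<not> ?thesis"
    then have "insert x S \<in> Q"
      using S unfolding Q_def by (auto simp: dist_commute not_less)
    from max[OF this] * show False by blast
  qed
  with S show ?thesis by (intro that[of S]) (auto simp: Q_def)
qed

text \<open>Sending a disjoint open ball to its label is measurable for the discrete
  \<open>\<sigma>\<close>-algebra, so the labels are atoms of a finite measure.\<close>

lemma countable_separated_set:
  fixes M :: "'a::metric_space measure" and S :: "'a set"
  assumes "finite_measure M" and sets: "sets M = sets borel" and supp: "measure_support M = UNIV" and e: "0 < e"
    and sep: "\<And>x y. x \<in> S \<Longrightarrow> y \<in> S \<Longrightarrow> x \<noteq> y \<Longrightarrow> e \<le> dist x y"
  shows "countable S"
proof -
  interpret finite_measure M by fact
  have uniq: "s = s'" if "s \<in> S" "s' \<in> S" "dist s x < e / 2" "dist s' x < e / 2" for s s' x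
    using sep[of s s'] that dist_triangle2[of s s' x] by fastforce
  define q where "q x = (if \<exists>s\<in>S. dist s x < e / 2
    then Some (THE s. s \<in> S \<and> dist s x < e / 2) else None)" for x
  have q_Some: "q x = Some s \<longleftrightarrow> s \<in> S \<and> dist s x < e / 2" for x s
  proof -
    have "(THE s. s \<in> S \<and> dist s x < e / 2) = s" if "s \<in> S" "dist s x < e / 2" for s
      using that uniq by (intro the_equality) blast+
    then show ?thesis unfolding q_def by auto
  qed
  have sp: "space M = UNIV" using sets_eq_imp_space_eq[OF sets] by simp
  \<comment> \<open>Any union of open balls is open, so every set of labels has a measurable
    preimage even before \<open>S\<close> is known to be countable.\<close>
  have pre: "q -` (Some ` X) = (\<Union>s\<in>S\<inter>X. ball s (e / 2))" for X
    using q_Some by (auto simp: q_Some[symmetric] image_iff)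
  have q_meas: "q \<in> M \<rightarrow>\<^sub>M count_space UNIV"
  proof (rule measurableI)
    fix Y :: "'a option set"
    define X where "X = {s. Some s \<in> Y}"
    have Sx: "q -` (Some ` Z) \<in> sets M" for Z
      unfolding pre sets by (intro borel_open) auto
    have "q -` Y = (if None \<in> Y then - (q -` (Some ` (- X))) else q -` (Some ` X))"
    proof (rule set_eqI)
      fix x
      show "x \<in> q -` Y \<longleftrightarrow>
          x \<in> (if None \<in> Y then - (q -` (Some ` (- X))) else q -` (Some ` X))"
        by (cases "q x") (auto simp: X_def)
    qed
    moreover have "- Z \<in> sets M" if "Z \<in> sets M" for Z
      using sets.compl_sets[OF that] sp by (simp add: Compl_eq_Diff_UNIV)
    ultimately show "q -` Y \<inter> space M \<in> sets M"
      using Sx sp by auto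
  qed simp
  interpret d: finite_measure "distr M (count_space UNIV) q"
    using q_meas by (rule finite_measure_distr)
  have "countable {y. measure (distr M (count_space UNIV) q) {y} \<noteq> 0}"
    by (rule d.countable_support)
  moreover have "Some ` S \<subseteq> {y. measure (distr M (count_space UNIV) q) {y} \<noteq> 0}"
  proof safe
    fix s assume "s \<in> S" and z: "measure (distr M (count_space UNIV) q) {Some s} = 0"
    have "q -` {Some s} = ball s (e / 2)" using pre[of "{s}"] \<open>s \<in> S\<close> by auto
    then have "measure M (ball s (e / 2)) = 0"
      using z q_meas sp by (simp add: measure_distr)
    moreover have "emeasure M (ball s (e / 2)) > 0"
      using e by (intro measure_supportD[of s]) (simp_all add: supp)
    ultimately show False by (simp add: emeasure_eq_measure)
  qed
  ultimately have "countable (Some ` S)" by (rule countable_subset[rotated])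
  then show ?thesis by (simp add: countable_image_inj_eq)
qed

text \<open>Maximal \<open>1 / Suc n\<close>-separated sets are countable by the preceding lemma,
  and their union over \<open>n\<close> is dense.\<close>

lemma support_UNIV_imp_separable:
  fixes M :: "'a::metric_space measure"
  assumes "finite_measure M" and "sets M = sets borel" and "measure_support M = UNIV"
  obtains A :: "'a set" where "countable A" "\<And>x e. 0 < e \<Longrightarrow> \<exists>a\<in>A. dist x a < e"
proof -
  have "\<exists>S::'a set. countable S \<and> (\<forall>x. \<exists>s\<in>S. dist x s < 1 / Suc n)" for n
  proof -
    obtain S :: "'a set"
      where S: "\<And>x y. x \<in> S \<Longrightarrow> y \<in> S \<Longrightarrow> x \<noteq> y \<Longrightarrow> 1 / Suc n \<le> dist x y"
        "\<And>x. \<exists>s\<in>S. x = s \<or> dist x s < 1 / Suc n"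
      by (rule maximal_separated_set[of "1 / Suc n"]) blast
    have "countable S"
      by (rule countable_separated_set[OF assms, where e = "1 / Suc n"]) (use S(1) in auto)
    moreover have "\<exists>s\<in>S. dist x s < 1 / Suc n" for x
      using S(2)[of x]
      by (metis dist_self of_nat_0_less_iff zero_less_Suc zero_less_divide_1_iff)
    ultimately show ?thesis by blast
  qed
  then obtain S :: "nat \<Rightarrow> 'a set"
    where S: "\<And>n. countable (S n)" "\<And>n x. \<exists>s\<in>S n. dist x s < 1 / Suc n"
    by metis
  show ?thesis
  proof (rule that[of "\<Union>n. S n"])
    fix x and e :: real assume "0 < e"
    then obtain n where "1 / Suc n < e" by (rule nat_approx_posE)
    with S(2)[of n x] show "\<exists>a\<in>\<Union>n. S n. dist x a < e" by force
  qed (use S in auto)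
qed

text \<open>The inclusion of the Borel algebra in the product algebra needs every open set to be a
  countable union of boxes, which a countable dense set supplies. It makes continuous functions on
  the square, such as \<open>dist\<close>, measurable for the product of the measures.\<close>

lemma borel_prod_separable:
  fixes A :: "'a::metric_space set"
  assumes "countable A" and dense: "\<And>x e. 0 < e \<Longrightarrow> \<exists>a\<in>A. dist x a < e"
  shows "sets (borel \<Otimes>\<^sub>M borel) = sets (borel :: ('a \<times> 'a) measure)"
proof (rule antisym)
  show "sets (borel \<Otimes>\<^sub>M borel) \<subseteq> sets (borel :: ('a \<times> 'a) measure)"
  proof (rule sets_pair_in_sets)
    fix X Y :: "'a set" assume "X \<in> sets borel" "Y \<in> sets borel"
    then have "fst -` X \<inter> snd -` Y \<in> sets (borel :: ('a \<times> 'a) measure)"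
      by (intro sets.Int measurable_sets_borel[OF borel_measurable_continuous_onI] continuous_intros)
    moreover have "fst -` X \<inter> snd -` Y = X \<times> Y" by auto
    ultimately show "X \<times> Y \<in> sets (borel :: ('a \<times> 'a) measure)" by simp
  qed
  have "U \<in> sets (borel \<Otimes>\<^sub>M borel)" if "open U" for U :: "('a \<times> 'a) set"
  proof -
    define I where "I = {(a, a', n::nat). a \<in> A \<and> a' \<in> A \<and>
      ball a (1 / Suc n) \<times> ball a' (1 / Suc n) \<subseteq> U}"
    have "countable (A \<times> A \<times> (UNIV :: nat set))" using assms(1) by auto
    then have "countable I" by (rule countable_subset[rotated]) (auto simp: I_def)
    moreover have "U = (\<Union>(a, a', n)\<in>I. ball a (1 / Suc n) \<times> ball a' (1 / Suc n))"
    proof (intro equalityI subsetI)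
      fix z assume "z \<in> U"
      obtain x y where z: "z = (x, y)" by fastforce
      obtain V W where VW: "open V" "open W" "x \<in> V" "y \<in> W" "V \<times> W \<subseteq> U"
        using open_prod_elim[OF \<open>open U\<close> \<open>z \<in> U\<close>] z by (metis mem_Times_iff fst_conv snd_conv)
      obtain e where e: "0 < e" "ball x e \<subseteq> V" "ball y e \<subseteq> W"
      proof -
        obtain e1 e2 where "0 < e1" "ball x e1 \<subseteq> V" "0 < e2" "ball y e2 \<subseteq> W"
          using VW by (meson open_contains_ball)
        then show ?thesis by (intro that[of "min e1 e2"]) auto
      qed
      \<comment> \<open>The box is centred at a point of \<open>A\<close> rather than at
        \<open>z\<close>, so its points may be almost \<open>2 / Suc n\<close> away from those of
        \<open>z\<close>.\<close>
      obtain n where n: "1 / Suc n < e / 2" using e(1) by (meson half_gt_zero nat_approx_posE)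
      obtain a a' where a: "a \<in> A" "a' \<in> A" "dist x a < 1 / Suc n" "dist y a' < 1 / Suc n"
        using dense[of "1 / Suc n"] by (metis of_nat_0_less_iff zero_less_Suc zero_less_divide_1_iff)
      have sub: "ball b (1 / Suc n) \<subseteq> ball w e" if "dist w b < 1 / Suc n" for w b :: 'a
      proof
        fix p assume "p \<in> ball b (1 / Suc n)"
        then show "p \<in> ball w e"
          using that n dist_triangle[of w p b] by simp
      qed
      have "ball a (1 / Suc n) \<times> ball a' (1 / Suc n) \<subseteq> U"
        using sub[OF a(3)] sub[OF a(4)] e VW by blast
      then have "(a, a', n) \<in> I" using a by (simp add: I_def)
      moreover have "z \<in> ball a (1 / Suc n) \<times> ball a' (1 / Suc n)"
        using a z by (simp add: dist_commute)
      ultimately show "z \<in> (\<Union>(a, a', n)\<in>I. ball a (1 / Suc n) \<times> ball a' (1 / Suc n))"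
        by blast
    qed (auto simp: I_def)
    moreover have "(\<Union>(a, a', n)\<in>I. ball a (1 / Suc n) \<times> ball a' (1 / Suc n))
        \<in> sets (borel \<Otimes>\<^sub>M borel)"
      using \<open>countable I\<close> by (intro sets.countable_UN') auto
    ultimately show ?thesis by simp
  qed
  then show "sets (borel :: ('a \<times> 'a) measure) \<subseteq> sets (borel \<Otimes>\<^sub>M borel)"
    using sets.sigma_sets_subset'[of "{U. open U}" "borel \<Otimes>\<^sub>M borel :: ('a \<times> 'a) measure"]
    by (auto simp: borel_def space_pair_measure)
qed

section \<open>Majorizing measures\<close>

lemma sum_le_suminf_ennreal: "sum g {..n} \<le> (\<Sum>k. g k)" for g :: "nat \<Rightarrow> ennreal"
  by (rule sum_le_suminf) auto

lemma emeasure_lborel_Ioi: "emeasure lborel {l::real<..} = \<top>"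
proof (rule ccontr)
  assume "emeasure lborel {l<..} \<noteq> \<top>"
  then obtain r where r: "0 \<le> r" "emeasure lborel {l<..} = ennreal r"
    by (cases "emeasure lborel {l<..}" rule: ennreal_cases) auto
  have "emeasure lborel {l<..<l + (r + 1)} \<le> emeasure lborel {l<..}"
    by (intro emeasure_mono) auto
  with r show False by simp
qed

locale majorizing_measure = prob_space m
  for m :: "'a::metric_space measure" +
  fixes \<phi> :: "real \<Rightarrow> real" and a b R :: real
  assumes sets_m [measurable_cong]: "sets m = sets borel"
    and support_m: "measure_support m = UNIV"
    and a_nonneg: "0 \<le> a" and b_nonneg: "0 \<le> b"
    and growth: "\<phi> \<in> growth_class a b"
    and R_ge: "2 \<le> R"
begin

lemma space_m [simp]: "space m = UNIV"
  using sets_eq_imp_space_eq[OF sets_m] by simp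

lemma sets_pair_m: "sets (m \<Otimes>\<^sub>M m) = sets borel"
proof -
  obtain A :: "'a set" where "countable A" "\<And>x e. 0 < e \<Longrightarrow> \<exists>a\<in>A. dist x a < e"
    using support_UNIV_imp_separable[OF finite_measure_axioms sets_m support_m] by blast
  then show ?thesis
    using borel_prod_separable sets_pair_measure_cong[OF sets_m sets_m] by blast
qed

lemma pair_measurable_continuous:
  fixes g :: "'a \<times> 'a \<Rightarrow> real"
  assumes "continuous_on UNIV g"
  shows "g \<in> borel_measurable (m \<Otimes>\<^sub>M m)"
  using borel_measurable_continuous_onI[OF assms] measurable_cong_sets[OF sets_pair_m refl] by blast

lemma measurable_continuous:
  fixes g :: "'a \<Rightarrow> real"
  assumes "continuous_on UNIV g"
  shows "g \<in> borel_measurable m"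
  using borel_measurable_continuous_onI[OF assms] measurable_cong_sets[OF sets_m refl] by blast

lemma closed_in_sets: "closed X \<Longrightarrow> X \<in> sets m"
  and open_in_sets: "open X \<Longrightarrow> X \<in> sets m"
  by (simp_all add: sets_m)

lemma prob_ball_pos: "0 < e \<Longrightarrow> 0 < prob (ball x e)"
  using measure_supportD[of x m "ball x e"] by (simp add: support_m emeasure_eq_measure)

lemma prob_cball_pos: "0 < e \<Longrightarrow> 0 < prob (cball x e)"
  by (rule less_le_trans[OF prob_ball_pos[of e x]])
     (auto intro!: finite_measure_mono closed_in_sets)

text \<open>The exceptional set is open and null, hence empty because the support is the whole
  space.\<close>

lemma AE_imp_all_continuous:
  fixes g :: "'a \<Rightarrow> real"
  assumes "continuous_on UNIV g" and "AE x in m. g x = l"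
  shows "g x = l"
proof (rule ccontr)
  assume ne: "g x \<noteq> l"
  have op: "open {y. g y \<noteq> l}"
    using continuous_on_open_vimage[OF open_UNIV, of g] assms(1)
    by (auto simp: vimage_def dest!: spec[of _ "- {l}"])
  then have "emeasure m {y. g y \<noteq> l} > 0"
    using ne by (intro measure_supportD[of x]) (simp_all add: support_m)
  moreover have "emeasure m {y. g y \<noteq> l} = 0"
    using assms(2) AE_iff_measurable[OF open_in_sets[OF op], of "\<lambda>y. g y = l"] by simp
  ultimately show False by simp
qed

section \<open>The growth function and its inverse\<close>

lemma phi_less: "0 \<le> x \<Longrightarrow> x < y \<Longrightarrow> \<phi> x < \<phi> y"
  and phi_0 [simp]: "\<phi> 0 = 0"
  and phi_onto: "\<phi> ` {0..} = {0..}"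
  and phi_cont: "continuous_on {0..} \<phi>"
  and phi_growth: "0 \<le> x \<Longrightarrow> half_inv \<phi> 1 \<le> y \<Longrightarrow> x \<le> a + b * (\<phi> (x * y) / \<phi> y)"
  using growth unfolding growth_class_def strict_mono_on_def by auto

lemma phi_le: "0 \<le> x \<Longrightarrow> x \<le> y \<Longrightarrow> \<phi> x \<le> \<phi> y"
  using phi_less[of x y] by (cases "x = y") auto

lemma phi_less_iff: "0 \<le> x \<Longrightarrow> 0 \<le> y \<Longrightarrow> \<phi> x < \<phi> y \<longleftrightarrow> x < y"
  using phi_less[of x y] phi_le[of y x] by linarith

lemma phi_nonneg: "0 \<le> x \<Longrightarrow> 0 \<le> \<phi> x"
  using phi_le[of 0 x] by simp

lemma phi_inj: "inj_on \<phi> {0..}"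
proof (rule inj_onI)
  fix x y assume "x \<in> {0..}" "y \<in> {0..}" "\<phi> x = \<phi> y"
  then show "x = y" using phi_less[of x y] phi_less[of y x] by (cases x y rule: linorder_cases) auto
qed

lemma half_inv_nonneg: "0 \<le> y \<Longrightarrow> 0 \<le> half_inv \<phi> y"
  using the_inv_into_into[OF phi_inj, of y "{0..}"] phi_onto by auto

lemma phi_half_inv: "0 \<le> y \<Longrightarrow> \<phi> (half_inv \<phi> y) = y"
  using f_the_inv_into_f[OF phi_inj, of y] phi_onto by auto

lemma half_inv_1_pos: "0 < half_inv \<phi> 1"
  using half_inv_nonneg[of 1] phi_half_inv[of 1] phi_0
  by (metis less_eq_real_def zero_le_one zero_neq_one)

lemma le_half_inv: "0 \<le> x \<Longrightarrow> \<phi> x \<le> y \<Longrightarrow> x \<le> half_inv \<phi> y"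
  using phi_nonneg[of x] half_inv_nonneg[of y] phi_half_inv[of y] phi_less_iff[of "half_inv \<phi> y" x]
  by simp

lemma b_pos: "0 < b"
proof (rule ccontr)
  assume "\<not> 0 < b"
  then show False using b_nonneg a_nonneg phi_growth[of "a + 1" "half_inv \<phi> 1"] by simp
qed

lemma phi_measurable:
  assumes [measurable]: "g \<in> borel_measurable M" and "\<And>x. 0 \<le> g x"
  shows "(\<lambda>x. \<phi> (g x)) \<in> borel_measurable M"
proof -
  \<comment> \<open>Continuity of \<open>\<phi>\<close> is known on the half-line only; composing
    with \<open>max 0\<close> extends it to all reals.\<close>
  have "continuous_on UNIV (\<phi> \<circ> (\<lambda>x. max 0 x))"
    by (rule continuous_on_compose)
       (auto intro!: continuous_intros continuous_on_subset[OF phi_cont])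
  then have "(\<phi> \<circ> (\<lambda>x. max 0 x)) \<in> borel_measurable borel"
    by (rule borel_measurable_continuous_onI)
  from measurable_compose[OF assms(1) this] show ?thesis
    using assms(2) by (simp add: max_def)
qed

text \<open>On the diagonal this is \<open>\<phi> 0 = 0\<close>, thanks to \<open>0 / 0 = 0\<close>.\<close>

definition slope :: "('a \<Rightarrow> real) \<Rightarrow> 'a \<Rightarrow> 'a \<Rightarrow> real" where
  "slope f u v = \<phi> (\<bar>f u - f v\<bar> / dist u v)"

lemma slope_nonneg: "0 \<le> slope f u v"
  unfolding slope_def by (intro phi_nonneg) simp

lemma slope_measurable [measurable]:
  assumes "continuous_on UNIV f"
  shows "case_prod (slope f) \<in> borel_measurable (m \<Otimes>\<^sub>M m)"
proof -
  have f: "continuous_on S (\<lambda>z. f (h z))" if "continuous_on S h" for S and h :: "'a \<times> 'a \<Rightarrow> 'a"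
    using continuous_on_compose2[OF assms that] by simp
  have "(\<lambda>z. \<bar>f (fst z) - f (snd z)\<bar>) \<in> borel_measurable (m \<Otimes>\<^sub>M m)"
    "(\<lambda>z. dist (fst z) (snd z)) \<in> borel_measurable (m \<Otimes>\<^sub>M m)"
    by (intro pair_measurable_continuous continuous_intros f)+
  then have "(\<lambda>z. \<bar>f (fst z) - f (snd z)\<bar> / dist (fst z) (snd z)) \<in> borel_measurable (m \<Otimes>\<^sub>M m)"
    by simp
  from phi_measurable[OF this] show ?thesis
    by (simp add: slope_def case_prod_beta')
qed

definition c :: "nat \<Rightarrow> real" where "c k = half_inv \<phi> 1 * R ^ k"

lemma c_pos: "0 < c k" and c_Suc: "c (Suc k) = R * c k" and c_ge: "half_inv \<phi> 1 \<le> c k"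
  using half_inv_1_pos R_ge by (auto simp: c_def)

lemma phi_c_ge_1: "1 \<le> \<phi> (c k)"
  using phi_le[OF _ c_ge[of k]] half_inv_1_pos phi_half_inv[of 1] by simp

text \<open>This normalisation forces the balls of level 0 to have full measure, which is where the
  chaining starts.\<close>

lemma phi_c_0: "\<phi> (c 0) = 1"
  by (simp add: c_def phi_half_inv)

text \<open>The factor is the geometric series \<open>1 + 1/R + 1/R^2 + ...\<close>.\<close>

lemma sum_c_le: "(\<Sum>k\<le>n. c k) \<le> R / (R - 1) * c n"
proof (induction n)
  case 0
  then show ?case using R_ge c_pos[of 0] by (simp add: field_simps)
next
  case (Suc n)
  then show ?case using R_ge by (simp add: c_Suc field_simps)
qed

lemma eventually_phi_c_ge: "\<exists>N. \<forall>n\<ge>N. y \<le> \<phi> (c n)"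
proof -
  obtain N where N: "half_inv \<phi> (max 0 y) / half_inv \<phi> 1 < R ^ N"
    using real_arch_pow[of R] R_ge by force
  have "y \<le> \<phi> (c n)" if "N \<le> n" for n
  proof -
    have "half_inv \<phi> (max 0 y) \<le> half_inv \<phi> 1 * R ^ N"
      using N half_inv_1_pos by (simp add: field_simps)
    also have "\<dots> \<le> c n"
      unfolding c_def using that R_ge half_inv_1_pos
      by (intro mult_left_mono power_increasing) auto
    finally have "\<phi> (half_inv \<phi> (max 0 y)) \<le> \<phi> (c n)"
      by (intro phi_le half_inv_nonneg) auto
    then show ?thesis by (simp add: phi_half_inv)
  qed
  then show ?thesis by blast
qed

text \<open>Serves the case in which an infinite \<open>maj_S\<close> is multiplied by a vanishing
  integral, so that the right-hand side gives nothing through it. Fubini yields one \<open>u\<close>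
  with \<open>f v = f u\<close> for almost all \<open>v\<close>, and continuity with full support
  extends this to every \<open>v\<close>.\<close>

lemma eq_integral_if_slope_vanishes:
  assumes f: "continuous_on UNIV f" and z: "(\<integral>\<^sup>+(u, v). ennreal (slope f u v) \<partial>(m \<Otimes>\<^sub>M m)) = 0"
  shows "f t = (\<integral>u. f u \<partial>m)"
proof -
  interpret pair_sigma_finite m m ..
  have [measurable]: "case_prod (slope f) \<in> borel_measurable (m \<Otimes>\<^sub>M m)"
    by (rule slope_measurable[OF f])
  have "AE z in m \<Otimes>\<^sub>M m. ennreal (case_prod (slope f) z) = 0"
    using z by (subst (asm) nn_integral_0_iff_AE) (auto simp: case_prod_beta')
  then have "AE u in m. AE v in m. slope f u v = 0"
    using slope_nonneg by (auto dest!: AE_pair simp: ennreal_eq_0_iff order_antisym)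
  moreover have "f u = f v" if "slope f u v = 0" for u v
  proof (rule ccontr)
    assume ne: "f u \<noteq> f v"
    then have "u \<noteq> v" by auto
    with ne have "0 < \<bar>f u - f v\<bar> / dist u v" by simp
    from phi_less[OF order_refl this] that show False by (simp add: slope_def)
  qed
  ultimately have "AE u in m. AE v in m. f v = f u"
    by (auto elim!: eventually_mono)
  then obtain u where "AE v in m. f v = f u"
    using eventually_happens'[OF ae_filter_bot] by blast
  then have "f v = f u" for v
    using AE_imp_all_continuous[OF f] by blast
  then have "f = (\<lambda>_. f u)" by auto
  then show ?thesis by (metis (no_types, lifting) Bochner_Integration.integral_cong lebesgue_integral_const prob_space scaleR_one)
qed

end

section \<open>Radii and averaging operators\<close>

text \<open>A finite diameter guarantees a ball of full measure around each point, as the radius of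
  level 0 requires. An infinite diameter makes \<open>maj_S\<close> infinite and is treated
  separately.\<close>

locale bounded_majorizing_measure = majorizing_measure m \<phi> a b R
  for m :: "'a::metric_space measure" and \<phi> :: "real \<Rightarrow> real" and a b R :: real +
  assumes ediam_finite: "ediam (UNIV :: 'a set) < \<top>"
begin

definition D :: real where "D = enn2real (ediam (UNIV :: 'a set))"

lemma ediam_eq: "ediam (UNIV :: 'a set) = ennreal D"
  using ediam_finite by (simp add: D_def)

lemma D_nonneg: "0 \<le> D"
  by (simp add: D_def)

lemma dist_le_D: "dist (x::'a) y \<le> D"
proof -
  have "ennreal (dist x y) \<le> ediam (UNIV :: 'a set)"
    unfolding ediam_def by (rule SUP_upper2[of "(x, y)"]) auto
  then show ?thesis by (simp add: ediam_eq D_nonneg)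
qed

lemma cball_D: "cball (x::'a) D = UNIV"
  using dist_le_D by auto

definition radius :: "nat \<Rightarrow> 'a \<Rightarrow> real" where
  "radius k x = Inf {e. 0 \<le> e \<and> 1 / \<phi> (c k) \<le> prob (cball x e)}"

lemma D_admissible: "D \<in> {e. 0 \<le> e \<and> 1 / \<phi> (c k) \<le> prob (cball x e)}"
  using D_nonneg phi_c_ge_1[of k] prob_space by (simp add: cball_D)

lemma admissible_bdd_below: "bdd_below {e. 0 \<le> e \<and> 1 / \<phi> (c k) \<le> prob (cball x e)}"
  by (rule bdd_belowI[of _ 0]) auto

lemma radius_leI: "0 \<le> e \<Longrightarrow> 1 / \<phi> (c k) \<le> prob (cball x e) \<Longrightarrow> radius k x \<le> e"
  unfolding radius_def by (rule cInf_lower[OF _ admissible_bdd_below]) simp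

lemma radius_nonneg: "0 \<le> radius k x"
  unfolding radius_def by (rule cInf_greatest) (use D_admissible in blast, simp)

lemma radius_le_D: "radius k x \<le> D"
  using D_admissible[of k x] by (intro radius_leI) auto

text \<open>The infimum is attained: the closed balls of radius
  \<open>radius k x + 1 / Suc n\<close> decrease to the closed ball of radius
  \<open>radius k x\<close>, and the measure is continuous from above.\<close>

lemma prob_cball_radius: "1 / \<phi> (c k) \<le> prob (cball x (radius k x))"
proof -
  let ?r = "radius k x"
  have "(\<lambda>n. prob (cball x (?r + 1 / Suc n))) \<longlonglongrightarrow> prob (\<Inter>n. cball x (?r + 1 / Suc n))"
  proof (rule finite_Lim_measure_decseq)
    show "range (\<lambda>n. cball x (?r + 1 / Suc n)) \<subseteq> events" by (auto intro: closed_in_sets)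
    show "decseq (\<lambda>n. cball x (?r + 1 / Suc n))"
      by (intro decseq_SucI subset_cball add_left_mono) (simp add: frac_le)
  qed
  moreover have "(\<Inter>n. cball x (?r + 1 / Suc n)) = cball x ?r"
  proof (intro equalityI subsetI)
    fix y assume y: "y \<in> (\<Inter>n. cball x (?r + 1 / Suc n))"
    have "dist x y \<le> ?r + e" if "0 < e" for e
    proof -
      obtain n where "1 / Suc n < e" using \<open>0 < e\<close> by (rule nat_approx_posE)
      moreover have "dist x y \<le> ?r + 1 / Suc n" using y by (auto simp del: of_nat_Suc)
      ultimately show ?thesis by linarith
    qed
    then show "y \<in> cball x ?r" by (auto intro: field_le_epsilon)
  next
    fix y assume "y \<in> cball x ?r"
    then show "y \<in> (\<Inter>n. cball x (?r + 1 / Suc n))" by (auto intro: order_trans)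
  qed
  moreover have "1 / \<phi> (c k) \<le> prob (cball x (?r + 1 / Suc n))" for n
  proof -
    have "\<exists>e\<in>{e. 0 \<le> e \<and> 1 / \<phi> (c k) \<le> prob (cball x e)}. e < ?r + 1 / Suc n"
      using D_admissible[of k x] unfolding radius_def by (intro cInf_lessD) auto
    then obtain e where "1 / \<phi> (c k) \<le> prob (cball x e)" "e < ?r + 1 / Suc n" by blast
    moreover have "prob (cball x e) \<le> prob (cball x (?r + 1 / Suc n))"
      using \<open>e < _\<close> by (intro finite_measure_mono closed_in_sets) auto
    ultimately show ?thesis by linarith
  qed
  ultimately show ?thesis by (metis (no_types, lifting) LIMSEQ_le_const)
qed

lemma prob_cball_radius_pos: "0 < prob (cball x (radius k x))"
  using prob_cball_radius[of k x] phi_c_ge_1[of k]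
  by (meson less_le_trans zero_less_divide_1_iff zero_less_one)

text \<open>The smallest admissible ball around \<open>y\<close> lies in the ball around
  \<open>x\<close> whose radius is larger by \<open>dist x y\<close>.\<close>

lemma radius_triangle: "radius k x \<le> radius k y + dist x y"
proof (rule radius_leI)
  have "cball y (radius k y) \<subseteq> cball x (radius k y + dist x y)"
  proof
    fix z assume "z \<in> cball y (radius k y)"
    then show "z \<in> cball x (radius k y + dist x y)"
      using dist_triangle[of x z y] by simp
  qed
  then have "prob (cball y (radius k y)) \<le> prob (cball x (radius k y + dist x y))"
    by (intro finite_measure_mono closed_in_sets) auto
  with prob_cball_radius[of k y] show "1 / \<phi> (c k) \<le> prob (cball x (radius k y + dist x y))"
    by linarith
qed (simp add: radius_nonneg)

lemma radius_continuous: "continuous_on UNIV (radius k)"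
proof -
  have "1-lipschitz_on UNIV (radius k)"
  proof (rule lipschitz_onI)
    fix x y
    show "dist (radius k x) (radius k y) \<le> 1 * dist x y"
      using radius_triangle[of k x y] radius_triangle[of k y x]
      by (simp add: dist_real_def dist_commute)
  qed simp
  then show ?thesis by (rule lipschitz_on_continuous_on)
qed

lemma radius_measurable [measurable]: "radius k \<in> borel_measurable m"
  by (rule measurable_continuous[OF radius_continuous])

text \<open>Every ball of positive radius has positive measure, and \<open>\<phi> (c n)\<close>
  eventually exceeds the reciprocal of that measure.\<close>

lemma radius_eventually_le:
  assumes "0 < e"
  shows "\<exists>N. \<forall>n\<ge>N. radius n x \<le> e"
proof -
  obtain N where N: "\<And>n. N \<le> n \<Longrightarrow> 1 / prob (cball x e) \<le> \<phi> (c n)"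
    using eventually_phi_c_ge by metis
  have "radius n x \<le> e" if "N \<le> n" for n
  proof (rule radius_leI)
    show "1 / \<phi> (c n) \<le> prob (cball x e)"
      using N[OF that] prob_cball_pos[OF assms, of x] phi_c_ge_1[of n]
      by (simp add: field_simps)
  qed (use assms in simp)
  then show ?thesis by blast
qed

text \<open>A geometric series is comparable to its largest term, here the last \<open>c k\<close> below the integrand
  of \<open>\<sigma>\<close>.\<close>

lemma sum_c_radius_le_sigma:
  "(\<Sum>k\<le>n. ennreal (c k * radius k x)) \<le> ennreal (R / (R - 1)) * maj_sigma m \<phi> x"
proof -
  define g where "g e = half_inv \<phi> (1 / prob (cball x e))" for e
  have le_g: "(\<Sum>k\<le>n. c k * indicator {0<..<radius k x} e) \<le> R / (R - 1) * g e"
    if e: "0 < e" for e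
  proof (induction n)
    have g0: "0 \<le> g e" unfolding g_def by (intro half_inv_nonneg) simp
    \<comment> \<open>Below the minimal radius of level \<open>k\<close> the ball has measure less
      than \<open>1 / \<phi> (c k)\<close>.\<close>
    have c_le_g: "c k \<le> g e" if "e < radius k x" for k
    proof -
      have "prob (cball x e) < 1 / \<phi> (c k)"
        using radius_leI[of e k x] e that by linarith
      then have "\<phi> (c k) \<le> 1 / prob (cball x e)"
        using prob_cball_pos[OF e, of x] phi_c_ge_1[of k] by (simp add: field_simps)
      then show ?thesis unfolding g_def using c_pos[of k] by (intro le_half_inv) auto
    qed
    have top: "(\<Sum>k\<le>n. c k * indicator {0<..<radius k x} e) \<le> R / (R - 1) * g e"
      if "e < radius n x" for n
    proof -
      have "(\<Sum>k\<le>n. c k * indicator {0<..<radius k x} e) \<le> (\<Sum>k\<le>n. c k)"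
        using c_pos by (intro sum_mono) (auto simp: indicator_def less_imp_le)
      also have "\<dots> \<le> R / (R - 1) * c n" by (rule sum_c_le)
      also have "\<dots> \<le> R / (R - 1) * g e"
        using c_le_g[OF that] R_ge by (intro mult_left_mono) auto
      finally show ?thesis .
    qed
    \<comment> \<open>If \<open>e\<close> is not below the last radius, the last summand vanishes
      and the bound for the shorter sum applies; otherwise \<open>top\<close> bounds the whole sum
      at once.\<close>
    {
      case 0
      show ?case using top[of 0] g0 R_ge e by (cases "e < radius 0 x") auto
    next
      case (Suc n)
      then show ?case using top[of "Suc n"] e by (cases "e < radius (Suc n) x") auto
    }
  qed
  have int_c: "(\<integral>\<^sup>+e. ennreal (c k * indicator {0<..<radius k x} e) \<partial>lborel)
      = ennreal (c k * radius k x)" for k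
  proof -
    have "(\<integral>\<^sup>+e. ennreal (c k * indicator {0<..<radius k x} e) \<partial>lborel)
        = (\<integral>\<^sup>+e. ennreal (c k) * indicator {0<..<radius k x} e \<partial>lborel)"
      by (intro nn_integral_cong) (auto simp: indicator_def)
    also have "\<dots> = ennreal (c k) * emeasure lborel {0<..<radius k x}"
      by (simp add: nn_integral_cmult_indicator)
    also have "\<dots> = ennreal (c k * radius k x)"
      using radius_nonneg[of k x] c_pos[of k] by (simp add: ennreal_mult)
    finally show ?thesis .
  qed
  \<comment> \<open>The constant is moved to the finite sum, so that only an integrand already known
    to be measurable is multiplied by it.\<close>
  have "ennreal ((R - 1) / R) * (\<Sum>k\<le>n. ennreal (c k * radius k x))
      = ennreal ((R - 1) / R) * (\<integral>\<^sup>+e. (\<Sum>k\<le>n. ennreal (c k * indicator {0<..<radius k x} e)) \<partial>lborel)"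
    by (subst nn_integral_sum) (auto simp: int_c)
  also have "\<dots> = (\<integral>\<^sup>+e. ennreal ((R - 1) / R) * (\<Sum>k\<le>n. ennreal (c k * indicator {0<..<radius k x} e)) \<partial>lborel)"
    by (subst nn_integral_cmult) auto
  also have "\<dots> \<le> maj_sigma m \<phi> x"
    unfolding maj_sigma_def
  proof (intro nn_integral_mono)
    fix e
    have nn: "0 \<le> c k * indicator {0<..<radius k x} e" for k
      using c_pos[of k] by simp
    show "ennreal ((R - 1) / R) * (\<Sum>k\<le>n. ennreal (c k * indicator {0<..<radius k x} e))
      \<le> ennreal (half_inv \<phi> (1 / prob (cball x e))) * indicator {e. 0 < e \<and> ennreal e < ediam (UNIV :: 'a set)} e"
    proof (cases "0 < e \<and> e < D")
      case True
      have le: "(R - 1) / R * (\<Sum>k\<le>n. c k * indicator {0<..<radius k x} e) \<le> g e"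
        using le_g[of e] True R_ge by (simp add: field_simps)
      have ind: "indicator {e. 0 < e \<and> ennreal e < ediam (UNIV :: 'a set)} e = (1::ennreal)"
        using True by (simp add: ediam_eq ennreal_lessI)
      have eq: "ennreal ((R - 1) / R) * (\<Sum>k\<le>n. ennreal (c k * indicator {0<..<radius k x} e))
          = ennreal ((R - 1) / R * (\<Sum>k\<le>n. c k * indicator {0<..<radius k x} e))"
        using R_ge by (subst sum_ennreal[OF nn], subst ennreal_mult)
          (auto intro!: sum_nonneg simp: less_imp_le[OF c_pos])
      show ?thesis
        unfolding eq ind mult_1_right by (rule ennreal_leI[OF le[unfolded g_def]])
    next
      \<comment> \<open>No radius exceeds \<open>D\<close>, so all indicators vanish outside the
        range of integration of \<open>maj_sigma\<close>.\<close>
      case False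
      then have "indicator {0<..<radius k x} e = (0::real)" for k
        using radius_le_D[of k x] by (auto simp: indicator_def)
      then show ?thesis by simp
    qed
  qed
  finally have "ennreal (R / (R - 1)) * (ennreal ((R - 1) / R) * (\<Sum>k\<le>n. ennreal (c k * radius k x)))
      \<le> ennreal (R / (R - 1)) * maj_sigma m \<phi> x"
    by (rule mult_left_mono) simp
  moreover have "ennreal (R / (R - 1)) * ennreal ((R - 1) / R) = 1"
    using R_ge by (simp flip: ennreal_mult)
  ultimately show ?thesis by (simp flip: mult.assoc)
qed

section \<open>Averages over the balls, with \<open>kern\<close> as their densities\<close>

definition kern :: "nat \<Rightarrow> 'a \<Rightarrow> 'a \<Rightarrow> real" where
  "kern k u v = indicator {v. dist u v \<le> radius k u} v / prob (cball u (radius k u))"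

text \<open>Values in \<open>ennreal\<close> avoid integrability conditions on the averaged
  function.\<close>

definition avg :: "nat \<Rightarrow> ('a \<Rightarrow> ennreal) \<Rightarrow> 'a \<Rightarrow> ennreal" where
  "avg k h x = (\<integral>\<^sup>+v. ennreal (kern k x v) * h v \<partial>m)"

lemma kern_le: "kern k u v \<le> \<phi> (c k)"
  using prob_cball_radius[of k u] prob_cball_radius_pos[of u k] phi_c_ge_1[of k]
  by (simp add: kern_def indicator_def field_simps)

lemma kern_outside: "\<not> dist u v \<le> radius k u \<Longrightarrow> kern k u v = 0"
  by (simp add: kern_def)

lemma kern_pair_measurable [measurable]: "case_prod (kern k) \<in> borel_measurable (m \<Otimes>\<^sub>M m)"
proof -
  have [measurable]: "(\<lambda>z. dist (fst z) (snd z)) \<in> borel_measurable (m \<Otimes>\<^sub>M m)"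
    by (intro pair_measurable_continuous continuous_intros)
  \<comment> \<open>Writing the measure of the ball as a partial integral of a jointly measurable
    indicator makes it measurable in the centre.\<close>
  have prob_eq: "prob (cball u (radius k u))
      = enn2real (\<integral>\<^sup>+v. indicator {z. dist (fst z) (snd z) \<le> radius k (fst z)} (u, v) \<partial>m)" for u
  proof -
    have "(\<integral>\<^sup>+v. indicator {z. dist (fst z) (snd z) \<le> radius k (fst z)} (u, v) \<partial>m)
        = (\<integral>\<^sup>+v. indicator (cball u (radius k u)) v \<partial>m)"
      by (intro nn_integral_cong) (auto simp: indicator_def)
    also have "\<dots> = emeasure m (cball u (radius k u))"
      by (intro nn_integral_indicator closed_in_sets) simp
    finally show ?thesis by (simp add: emeasure_eq_measure)
  qed
  have "{z \<in> space (m \<Otimes>\<^sub>M m). dist (fst z) (snd z) \<le> radius k (fst z)} \<in> sets (m \<Otimes>\<^sub>M m)"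
    by measurable
  then have [measurable]: "{z. dist (fst z) (snd z) \<le> radius k (fst z)} \<in> sets (m \<Otimes>\<^sub>M m)"
    by (simp add: space_pair_measure)
  have [measurable]: "(\<lambda>u. prob (cball u (radius k u))) \<in> borel_measurable m"
    unfolding prob_eq by measurable
  have "(\<lambda>z. indicator {z. dist (fst z) (snd z) \<le> radius k (fst z)} z / prob (cball (fst z) (radius k (fst z))))
      \<in> borel_measurable (m \<Otimes>\<^sub>M m)"
    by measurable
  then show ?thesis by (simp add: kern_def case_prod_beta' indicator_def)
qed

lemma kern_measurable [measurable]: "kern k u \<in> borel_measurable m"
  using measurable_compose_Pair1[OF _ kern_pair_measurable, of u k] by simp

lemma avg_const: "avg k (\<lambda>_. l) x = l"
proof -
  have "(\<integral>\<^sup>+v. ennreal (kern k x v) \<partial>m) =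
      (\<integral>\<^sup>+v. ennreal (1 / prob (cball x (radius k x))) * indicator (cball x (radius k x)) v \<partial>m)"
    by (intro nn_integral_cong) (auto simp: kern_def indicator_def)
  also have "\<dots> = ennreal (1 / prob (cball x (radius k x))) * emeasure m (cball x (radius k x))"
    by (intro nn_integral_cmult_indicator closed_in_sets) simp
  also have "\<dots> = 1"
    using prob_cball_radius_pos[of x k] by (simp add: emeasure_eq_measure flip: ennreal_mult)
  finally show ?thesis unfolding avg_def by (subst nn_integral_multc) auto
qed

lemma avg_mono:
  assumes "\<And>v. dist x v \<le> radius k x \<Longrightarrow> h v \<le> h' v"
  shows "avg k h x \<le> avg k h' x"
  unfolding avg_def
proof (intro nn_integral_mono)
  fix v
  show "ennreal (kern k x v) * h v \<le> ennreal (kern k x v) * h' v"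
    using assms[of v] kern_outside[of x v k]
    by (cases "dist x v \<le> radius k x") (auto intro: mult_left_mono)
qed

lemma avg_add:
  assumes [measurable]: "h \<in> borel_measurable m" "h' \<in> borel_measurable m"
  shows "avg k (\<lambda>v. h v + h' v) x = avg k h x + avg k h' x"
  unfolding avg_def by (simp add: distrib_left nn_integral_add)

lemma avg_cmult:
  assumes [measurable]: "h \<in> borel_measurable m"
  shows "avg k (\<lambda>v. l * h v) x = l * avg k h x"
  unfolding avg_def by (subst nn_integral_cmult[symmetric]) (auto simp: mult_ac)

lemma avg_le_nn_integral:
  assumes [measurable]: "h \<in> borel_measurable m"
  shows "avg k h x \<le> ennreal (\<phi> (c k)) * (\<integral>\<^sup>+v. h v \<partial>m)"
proof -
  have "avg k h x \<le> (\<integral>\<^sup>+v. ennreal (\<phi> (c k)) * h v \<partial>m)"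
    unfolding avg_def using kern_le by (intro nn_integral_mono mult_right_mono ennreal_leI) auto
  then show ?thesis by (simp add: nn_integral_cmult)
qed

text \<open>The ball of level 0 has measure 1, so its kernel equals 1 almost everywhere.\<close>

lemma nn_integral_le_avg_0:
  assumes [measurable]: "h \<in> borel_measurable m"
  shows "(\<integral>\<^sup>+v. h v \<partial>m) \<le> avg 0 h x"
proof -
  have p: "prob (cball x (radius 0 x)) = 1"
    using prob_cball_radius[of 0 x] prob_le_1[of "cball x (radius 0 x)"] by (simp add: phi_c_0)
  then have "AE v in m. v \<in> cball x (radius 0 x)"
    by (intro AE_prob_1)
  then have "AE v in m. h v \<le> ennreal (kern 0 x v) * h v"
    by eventually_elim (simp add: kern_def p)
  then show ?thesis unfolding avg_def by (rule nn_integral_mono_AE)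
qed

section \<open>Chaining\<close>

text \<open>\<open>lip k\<close> is a Lipschitz constant of the error term \<open>err k\<close>, which is what averaging over a
  ball of the next radius adds to it.\<close>

primrec lip :: "nat \<Rightarrow> real" where
  "lip 0 = 0"
| "lip (Suc k) = 2 * lip k + 2 * c (Suc k)"

primrec err :: "nat \<Rightarrow> 'a \<Rightarrow> real" where
  "err 0 x = 0"
| "err (Suc k) x = err k x + (lip k + c (Suc k)) * radius (Suc k) x + c (Suc k) * radius k x"

lemma lip_nonneg: "0 \<le> lip k"
  using c_pos by (induction k) (auto intro: add_nonneg_nonneg simp: less_imp_le)

lemma err_nonneg: "0 \<le> err k x"
  using c_pos lip_nonneg radius_nonneg
  by (induction k) (auto intro!: add_nonneg_nonneg mult_nonneg_nonneg simp: less_imp_le)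

text \<open>As radii are 1-Lipschitz, the three summands of \<open>err (Suc k)\<close> contribute
  \<open>lip k\<close>, \<open>lip k + c (Suc k)\<close> and \<open>c (Suc k)\<close>, which add up
  to \<open>lip (Suc k)\<close>.\<close>

lemma err_triangle: "err k x \<le> err k y + lip k * dist x y"
proof (induction k)
  case (Suc k)
  have "(lip k + c (Suc k)) * radius (Suc k) x \<le> (lip k + c (Suc k)) * (radius (Suc k) y + dist x y)"
    using c_pos[of "Suc k"] lip_nonneg[of k] by (intro mult_left_mono radius_triangle) auto
  moreover have "c (Suc k) * radius k x \<le> c (Suc k) * (radius k y + dist x y)"
    using c_pos[of "Suc k"] by (intro mult_left_mono radius_triangle) auto
  ultimately show ?case using Suc by (simp add: algebra_simps)
qed simp

text \<open>The factor \<open>K = 2 * R / (R - 2)\<close> solves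
  \<open>R * K = 2 * K + 2 * R\<close>, so the recursion reproduces the bound. This is where growth
  of \<open>c\<close> faster than doubling enters.\<close>

lemma lip_le: "2 < R \<Longrightarrow> lip k \<le> 2 * R / (R - 2) * c k"
proof (induction k)
  case 0
  then show ?case using c_pos[of 0] by simp
next
  case (Suc k)
  then have "lip (Suc k) \<le> 2 * (2 * R / (R - 2) * c k) + 2 * (R * c k)" by (simp add: c_Suc)
  also have "\<dots> = 2 * R / (R - 2) * c (Suc k)"
    using Suc.prems by (simp add: c_Suc field_simps)
  finally show ?case .
qed

text \<open>When the recursion is unrolled, \<open>c k * radius k x\<close> appears with factor
  \<open>R\<close> as the old radius of a step and with factor at most \<open>R / (R - 2)\<close> as
  the new one. The two add up to \<open>R * (R - 1) / (R - 2)\<close>.\<close>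

lemma err_le:
  assumes "2 < R"
  shows "err n x \<le> R * (R - 1) / (R - 2) * (\<Sum>k\<le>n. c k * radius k x)"
proof -
  have nn: "0 \<le> c k * radius k x" for k
    using c_pos[of k] radius_nonneg[of k x] by simp
  have "err n x \<le> R * (\<Sum>k<n. c k * radius k x) + R / (R - 2) * (\<Sum>k\<le>n. c k * radius k x)"
  proof (induction n)
    case 0
    show ?case using assms nn[of 0] by simp
  next
    case (Suc n)
    have "lip n + c (Suc n) \<le> 2 * R / (R - 2) * c n + R * c n"
      using lip_le[OF assms, of n] by (simp add: c_Suc)
    also have "\<dots> = R / (R - 2) * c (Suc n)"
      using assms by (simp add: c_Suc field_simps)
    finally have "(lip n + c (Suc n)) * radius (Suc n) x \<le> R / (R - 2) * c (Suc n) * radius (Suc n) x"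
      by (intro mult_right_mono radius_nonneg)
    with Suc show ?case by (simp add: c_Suc algebra_simps)
  qed
  also have "\<dots> \<le> R * (\<Sum>k\<le>n. c k * radius k x) + R / (R - 2) * (\<Sum>k\<le>n. c k * radius k x)"
    using assms nn by (intro add_right_mono mult_left_mono sum_mono2) auto
  also have "\<dots> = R * (R - 1) / (R - 2) * (\<Sum>k\<le>n. c k * radius k x)"
    using assms by (simp add: field_simps)
  finally show ?thesis .
qed

definition slope_mean :: "('a \<Rightarrow> real) \<Rightarrow> nat \<Rightarrow> 'a \<Rightarrow> ennreal" where
  "slope_mean f k u = avg k (\<lambda>v. ennreal (slope f u v)) u"

lemma slope_mean_measurable:
  assumes f: "continuous_on UNIV f"
  shows "slope_mean f k \<in> borel_measurable m"
proof -
  note [measurable] = slope_measurable[OF f]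
  show ?thesis unfolding slope_mean_def avg_def by measurable
qed

text \<open>What is left of the \<open>b\<close>-part at level \<open>k\<close> after the kernel of
  level \<open>Suc k\<close> is replaced by its upper bound, which removes the dependence on the
  base point.\<close>

definition slope_energy :: "('a \<Rightarrow> real) \<Rightarrow> nat \<Rightarrow> ennreal" where
  "slope_energy f k = (\<integral>\<^sup>+u. ennreal (radius k u) * slope_mean f k u \<partial>m)"

text \<open>The growth condition at \<open>y = c (Suc k)\<close>; the resulting factor \<open>1 / \<phi> (c (Suc k))\<close>
  will compensate the bound \<open>\<phi> (c (Suc k))\<close> on the kernel of level \<open>Suc k\<close>.\<close>

lemma increment_le:
  assumes "dist u v \<le> radius k u"
  shows "\<bar>f u - f v\<bar> \<le> a * c (Suc k) * radius k u
    + b * c (Suc k) / \<phi> (c (Suc k)) * radius k u * slope f u v"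
proof -
  let ?y = "c (Suc k)"
  have y: "0 < ?y" "1 \<le> \<phi> ?y" by (rule c_pos phi_c_ge_1)+
  have nn: "0 \<le> a * ?y + b * ?y / \<phi> ?y * slope f u v"
    using y a_nonneg b_nonneg slope_nonneg[of f u v] by simp
  have "\<bar>f u - f v\<bar> \<le> dist u v * (a * ?y + b * ?y / \<phi> ?y * slope f u v)"
  proof (cases "u = v")
    case False
    have "\<bar>f u - f v\<bar> / dist u v / ?y \<le> a + b * (\<phi> (\<bar>f u - f v\<bar> / dist u v / ?y * ?y) / \<phi> ?y)"
      using y by (intro phi_growth c_ge) simp
    also have "\<bar>f u - f v\<bar> / dist u v / ?y * ?y = \<bar>f u - f v\<bar> / dist u v"
      using y by simp
    finally have "\<bar>f u - f v\<bar> / dist u v / ?y \<le> a + b * (slope f u v / \<phi> ?y)"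
      by (simp add: slope_def)
    then have "\<bar>f u - f v\<bar> \<le> (a + b * (slope f u v / \<phi> ?y)) * ?y * dist u v"
      using y False by (simp add: divide_le_eq mult_ac)
    then show ?thesis by (simp add: algebra_simps)
  qed simp
  also have "\<dots> \<le> radius k u * (a * ?y + b * ?y / \<phi> ?y * slope f u v)"
    using assms nn by (rule mult_right_mono)
  finally show ?thesis by (simp add: algebra_simps)
qed

lemma avg_increment_le:
  assumes f: "continuous_on UNIV f"
  shows "avg k (\<lambda>v. ennreal \<bar>f u - f v\<bar>) u \<le> ennreal (a * c (Suc k) * radius k u)
    + ennreal (b * c (Suc k) / \<phi> (c (Suc k))) * (ennreal (radius k u) * slope_mean f k u)"
proof -
  let ?K = "b * c (Suc k) / \<phi> (c (Suc k))"
  have K: "0 \<le> ?K" using b_nonneg c_pos[of "Suc k"] phi_c_ge_1[of "Suc k"] by simp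
  have p1: "0 \<le> a * c (Suc k) * radius k u"
    using a_nonneg c_pos[of "Suc k"] radius_nonneg[of k u] by simp
  have p2: "0 \<le> ?K * radius k u"
    by (rule mult_nonneg_nonneg[OF K radius_nonneg])
  have [measurable]: "slope f u \<in> borel_measurable m"
    using measurable_compose_Pair1[OF _ slope_measurable[OF f], of u] by simp
  have "avg k (\<lambda>v. ennreal \<bar>f u - f v\<bar>) u
      \<le> avg k (\<lambda>v. ennreal (a * c (Suc k) * radius k u) + ennreal (?K * radius k u) * ennreal (slope f u v)) u"
  proof (rule avg_mono)
    fix v assume "dist u v \<le> radius k u"
    from increment_le[OF this, of f]
    have "ennreal \<bar>f u - f v\<bar> \<le> ennreal (a * c (Suc k) * radius k u + ?K * radius k u * slope f u v)"
      by (rule ennreal_leI)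
    also have "\<dots> = ennreal (a * c (Suc k) * radius k u) + ennreal (?K * radius k u) * ennreal (slope f u v)"
      by (simp only: ennreal_plus[OF p1 mult_nonneg_nonneg[OF p2 slope_nonneg]]
          ennreal_mult[OF p2 slope_nonneg])
    finally show "ennreal \<bar>f u - f v\<bar> \<le>
      ennreal (a * c (Suc k) * radius k u) + ennreal (?K * radius k u) * ennreal (slope f u v)" .
  qed
  also have "\<dots> = ennreal (a * c (Suc k) * radius k u) + ennreal (?K * radius k u) * slope_mean f k u"
    by (simp add: avg_add avg_cmult avg_const slope_mean_def)
  finally show ?thesis
    by (simp only: ennreal_mult[OF K radius_nonneg] mult.assoc[where 'a = ennreal])
qed

text \<open>One link of the chain. The Lipschitz bounds move the \<open>a\<close>-part from
  \<open>u\<close> to the centre \<open>x\<close>, turning it into \<open>err (Suc k) x\<close>,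
  while the constant \<open>C\<close> is unchanged by averaging. In the \<open>b\<close>-part the
  kernel bound \<open>\<phi> (c (Suc k))\<close> cancels the denominator from
  \<open>increment_le\<close>.\<close>

lemma avg_Suc_le:
  assumes f: "continuous_on UNIV f"
    and h: "\<And>u. h u \<le> avg k (\<lambda>v. ennreal \<bar>f u - f v\<bar>) u + (ennreal (a * err k u) + C)"
  shows "avg (Suc k) h x \<le> ennreal (a * err (Suc k) x)
    + (C + ennreal b * (ennreal (c (Suc k)) * slope_energy f k))"
proof -
  let ?y = "c (Suc k)"
  let ?K = "b * ?y / \<phi> ?y"
  have y: "0 < ?y" "1 \<le> \<phi> ?y" by (rule c_pos phi_c_ge_1)+
  note [measurable] = slope_mean_measurable[OF f]
  have "avg (Suc k) h x \<le>
      avg (Suc k) (\<lambda>u. (ennreal (a * err (Suc k) x) + C)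
        + ennreal ?K * (ennreal (radius k u) * slope_mean f k u)) x"
  proof (rule avg_mono)
    fix u assume u: "dist x u \<le> radius (Suc k) x"
    have "err k u \<le> err k x + lip k * radius (Suc k) x"
      using err_triangle[of k u x] mult_left_mono[OF u lip_nonneg[of k]] by (simp add: dist_commute)
    moreover have "?y * radius k u \<le> ?y * (radius k x + radius (Suc k) x)"
      using radius_triangle[of k u x] u y by (intro mult_left_mono) (auto simp: dist_commute)
    ultimately have "?y * radius k u + err k u \<le> err (Suc k) x"
      by (simp add: algebra_simps)
    from mult_left_mono[OF this a_nonneg]
    have "ennreal (a * ?y * radius k u + a * err k u) \<le> ennreal (a * err (Suc k) x)"
      by (intro ennreal_leI) (simp add: algebra_simps)
    then have le: "ennreal (a * ?y * radius k u) + ennreal (a * err k u) \<le> ennreal (a * err (Suc k) x)"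
      using a_nonneg y radius_nonneg[of k u] err_nonneg[of k u] by (simp add: ennreal_plus)
    have "h u \<le> (ennreal (a * ?y * radius k u)
        + ennreal ?K * (ennreal (radius k u) * slope_mean f k u)) + (ennreal (a * err k u) + C)"
      by (rule order_trans[OF h add_right_mono[OF avg_increment_le[OF f]]])
    also have "\<dots> = ((ennreal (a * ?y * radius k u) + ennreal (a * err k u)) + C)
        + ennreal ?K * (ennreal (radius k u) * slope_mean f k u)"
      by (simp add: add_ac)
    also have "\<dots> \<le> (ennreal (a * err (Suc k) x) + C)
        + ennreal ?K * (ennreal (radius k u) * slope_mean f k u)"
      by (intro add_right_mono le)
    finally show "h u \<le> \<dots>" .
  qed
  also have "\<dots> = (ennreal (a * err (Suc k) x) + C)
      + ennreal ?K * avg (Suc k) (\<lambda>u. ennreal (radius k u) * slope_mean f k u) x"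
    by (simp add: avg_add avg_cmult avg_const)
  also have "\<dots> \<le> (ennreal (a * err (Suc k) x) + C)
      + ennreal ?K * (ennreal (\<phi> ?y) * slope_energy f k)"
    unfolding slope_energy_def by (intro add_left_mono mult_left_mono avg_le_nn_integral) auto
  also have "ennreal ?K * (ennreal (\<phi> ?y) * slope_energy f k)
      = ennreal b * (ennreal ?y * slope_energy f k)"
  proof -
    have "ennreal ?K * ennreal (\<phi> ?y) = ennreal b * ennreal ?y"
      using y b_nonneg by (simp flip: ennreal_mult)
    then show ?thesis by (simp flip: mult.assoc)
  qed
  finally show ?thesis by (simp add: add_ac)
qed

lemma deviation_le:
  assumes f: "continuous_on UNIV f" and bdd: "bounded (range f)"
  shows "ennreal \<bar>f u - (\<integral>v. f v \<partial>m)\<bar> \<le> (\<integral>\<^sup>+v. ennreal \<bar>f u - f v\<bar> \<partial>m)"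
proof -
  have [measurable]: "f \<in> borel_measurable m" by (rule measurable_continuous[OF f])
  obtain K where "\<And>v. \<bar>f v\<bar> \<le> K" using bdd by (auto simp: bounded_iff)
  then have int: "integrable m f" by (intro integrable_const_bound[of _ K]) auto
  then have "f u - (\<integral>v. f v \<partial>m) = (\<integral>v. f u - f v \<partial>m)" using prob_space by simp
  then have "ennreal \<bar>f u - (\<integral>v. f v \<partial>m)\<bar> = ennreal (norm (\<integral>v. f u - f v \<partial>m))" by simp
  also have "\<dots> \<le> (\<integral>\<^sup>+v. ennreal (norm (f u - f v)) \<partial>m)"
    using int by (intro integral_norm_bound_ennreal) auto
  finally show ?thesis by simp
qed

text \<open>The left-hand side does not depend on \<open>v\<close>, so it equals its own average,
  and the triangle inequality applies under the average.\<close>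

lemma deviation_le_avg:
  assumes f: "continuous_on UNIV f"
  shows "ennreal \<bar>f u - l\<bar> \<le> avg k (\<lambda>v. ennreal \<bar>f u - f v\<bar>) u + avg k (\<lambda>v. ennreal \<bar>f v - l\<bar>) u"
proof -
  have [measurable]: "f \<in> borel_measurable m" by (rule measurable_continuous[OF f])
  have "avg k (\<lambda>_. ennreal \<bar>f u - l\<bar>) u
      \<le> avg k (\<lambda>v. ennreal \<bar>f u - f v\<bar> + ennreal \<bar>f v - l\<bar>) u"
    by (intro avg_mono) (simp flip: ennreal_plus)
  then show ?thesis by (simp add: avg_const avg_add)
qed

text \<open>Telescoping by induction: \<open>deviation_le_avg\<close> splits the deviation into an
  increment and an averaged deviation, the induction hypothesis bounds the latter, and
  \<open>avg_Suc_le\<close> averages the sum once more. The start replaces the mean over the whole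
  space by an average of level 0.\<close>

lemma chaining:
  assumes f: "continuous_on UNIV f" and bdd: "bounded (range f)"
  shows "avg (Suc n) (\<lambda>u. ennreal \<bar>f u - (\<integral>v. f v \<partial>m)\<bar>) x
    \<le> ennreal (a * err (Suc n) x) + ennreal b * (\<Sum>k\<le>n. ennreal (c (Suc k)) * slope_energy f k)"
proof (induction n arbitrary: x)
  case 0
  have [measurable]: "f \<in> borel_measurable m" by (rule measurable_continuous[OF f])
  have "avg (Suc 0) (\<lambda>u. ennreal \<bar>f u - (\<integral>v. f v \<partial>m)\<bar>) x \<le> ennreal (a * err (Suc 0) x)
    + (0 + ennreal b * (ennreal (c (Suc 0)) * slope_energy f 0))"
  proof (rule avg_Suc_le[OF f])
    fix u
    have "ennreal \<bar>f u - (\<integral>v. f v \<partial>m)\<bar> \<le> (\<integral>\<^sup>+v. ennreal \<bar>f u - f v\<bar> \<partial>m)"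
      by (rule deviation_le[OF f bdd])
    also have "\<dots> \<le> avg 0 (\<lambda>v. ennreal \<bar>f u - f v\<bar>) u"
      by (rule nn_integral_le_avg_0) simp
    finally show "ennreal \<bar>f u - (\<integral>v. f v \<partial>m)\<bar>
        \<le> avg 0 (\<lambda>v. ennreal \<bar>f u - f v\<bar>) u + (ennreal (a * err 0 u) + 0)"
      by simp
  qed
  then show ?case by simp
next
  case (Suc n)
  let ?C = "ennreal b * (\<Sum>k\<le>n. ennreal (c (Suc k)) * slope_energy f k)"
  have "avg (Suc (Suc n)) (\<lambda>u. ennreal \<bar>f u - (\<integral>v. f v \<partial>m)\<bar>) x \<le> ennreal (a * err (Suc (Suc n)) x)
    + (?C + ennreal b * (ennreal (c (Suc (Suc n))) * slope_energy f (Suc n)))"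
    by (rule avg_Suc_le[OF f order_trans[OF deviation_le_avg[OF f] add_left_mono[OF Suc]]])
  then show ?case by (simp only: sum.atMost_Suc distrib_left)
qed

section \<open>The measure on the square\<close>

text \<open>Averages over shrinking balls recover \<open>f t\<close> by continuity, so the chaining
  bound passes to \<open>f t\<close> itself. \<open>E\<close> stands for the \<open>a\<close>-part,
  whose bound is infinite when \<open>R = 2\<close> and \<open>a > 0\<close>.\<close>

lemma deviation_bound:
  assumes f: "continuous_on UNIV f" and bdd: "bounded (range f)"
    and err: "\<And>n. ennreal (a * err n t) \<le> E"
  shows "ennreal \<bar>f t - (\<integral>v. f v \<partial>m)\<bar>
    \<le> E + ennreal (b * R) * (\<Sum>k. ennreal (c k) * slope_energy f k)"
proof (rule ennreal_le_epsilon)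
  fix e :: real assume "0 < e"
  let ?h = "\<lambda>u. ennreal \<bar>f u - (\<integral>v. f v \<partial>m)\<bar>"
  obtain d where d: "0 < d" "\<And>v. dist v t < d \<Longrightarrow> dist (f v) (f t) < e"
    using f \<open>0 < e\<close> by (metis UNIV_I continuous_on_iff)
  \<comment> \<open>The balls are closed while continuity asks for distance strictly below
    \<open>d\<close>, hence \<open>d / 2\<close>.\<close>
  obtain n where n: "radius (Suc n) t \<le> d / 2"
    using radius_eventually_le[of "d / 2" t] d(1) by (metis half_gt_zero le_SucI order_refl)
  have "?h t \<le> avg (Suc n) (\<lambda>v. ennreal \<bar>f t - f v\<bar>) t + avg (Suc n) ?h t"
    by (rule deviation_le_avg[OF f])
  also have "avg (Suc n) (\<lambda>v. ennreal \<bar>f t - f v\<bar>) t \<le> avg (Suc n) (\<lambda>_. ennreal e) t"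
  proof (intro avg_mono ennreal_leI)
    fix v assume "dist t v \<le> radius (Suc n) t"
    then show "\<bar>f t - f v\<bar> \<le> e"
      using d(2)[of v] n d(1) by (simp add: dist_commute dist_real_def)
  qed
  also have "\<dots> = ennreal e" by (rule avg_const)
  also have "avg (Suc n) ?h t \<le> ennreal (a * err (Suc n) t)
      + ennreal b * (\<Sum>k\<le>n. ennreal (c (Suc k)) * slope_energy f k)"
    by (rule chaining[OF f bdd])
  \<comment> \<open>Passing from \<open>c (Suc k)\<close> to \<open>c k\<close> produces the first
    factor \<open>R\<close> of the constant \<open>B\<close>.\<close>
  also have "(\<Sum>k\<le>n. ennreal (c (Suc k)) * slope_energy f k)
      = ennreal R * (\<Sum>k\<le>n. ennreal (c k) * slope_energy f k)"
    using R_ge c_pos by (simp add: c_Suc ennreal_mult sum_distrib_left mult.assoc less_imp_le)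
  also have "ennreal (a * err (Suc n) t)
      + ennreal b * (ennreal R * (\<Sum>k\<le>n. ennreal (c k) * slope_energy f k))
      \<le> E + ennreal b * (ennreal R * (\<Sum>k. ennreal (c k) * slope_energy f k))"
    by (intro add_mono err mult_left_mono sum_le_suminf_ennreal) auto
  finally show "?h t \<le> E + ennreal (b * R) * (\<Sum>k. ennreal (c k) * slope_energy f k) + ennreal e"
    using R_ge b_nonneg by (simp add: ennreal_mult add_ac mult.assoc)
qed

text \<open>Up to normalisation, the density of the desired measure with respect to
  \<open>m \<Otimes>\<^sub>M m\<close>.\<close>

definition weight :: "'a \<times> 'a \<Rightarrow> ennreal" where
  "weight = (\<lambda>(u, v). \<Sum>k. ennreal (c k * radius k u) * ennreal (kern k u v))"

lemma weight_measurable [measurable]: "weight \<in> borel_measurable (m \<Otimes>\<^sub>M m)"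
  unfolding weight_def by measurable

definition mass :: ennreal where
  "mass = (\<integral>\<^sup>+z. weight z \<partial>(m \<Otimes>\<^sub>M m))"

text \<open>Applied to the slopes of \<open>f\<close> it yields the energies of
  \<open>deviation_bound\<close>; applied to the constant 1 it yields \<open>mass\<close>.\<close>

lemma nn_integral_weight_mult:
  assumes [measurable]: "case_prod g \<in> borel_measurable (m \<Otimes>\<^sub>M m)"
  shows "(\<integral>\<^sup>+z. weight z * ennreal (case_prod g z) \<partial>(m \<Otimes>\<^sub>M m))
    = (\<Sum>k. ennreal (c k) * (\<integral>\<^sup>+u. ennreal (radius k u) * avg k (\<lambda>v. ennreal (g u v)) u \<partial>m))"
proof -
  have "(\<integral>\<^sup>+z. weight z * ennreal (case_prod g z) \<partial>(m \<Otimes>\<^sub>M m))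
      = (\<integral>\<^sup>+u. \<integral>\<^sup>+v. weight (u, v) * ennreal (g u v) \<partial>m \<partial>m)"
    by (subst nn_integral_fst[symmetric]) auto
  also have "\<dots> = (\<integral>\<^sup>+u. \<integral>\<^sup>+v. (\<Sum>k. ennreal (c k * radius k u) * (ennreal (kern k u v) * ennreal (g u v))) \<partial>m \<partial>m)"
    by (simp add: weight_def ennreal_suminf_multc[symmetric] mult.assoc)
  also have "\<dots> = (\<integral>\<^sup>+u. (\<Sum>k. \<integral>\<^sup>+v. ennreal (c k * radius k u) * (ennreal (kern k u v) * ennreal (g u v)) \<partial>m) \<partial>m)"
    by (intro nn_integral_cong nn_integral_suminf) measurable
  also have "\<dots> = (\<integral>\<^sup>+u. (\<Sum>k. ennreal (c k * radius k u) * avg k (\<lambda>v. ennreal (g u v)) u) \<partial>m)"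
    unfolding avg_def by (intro nn_integral_cong suminf_cong nn_integral_cmult) measurable
  also have "\<dots> = (\<Sum>k. \<integral>\<^sup>+u. ennreal (c k * radius k u) * avg k (\<lambda>v. ennreal (g u v)) u \<partial>m)"
    unfolding avg_def by (intro nn_integral_suminf) measurable
  also have "\<dots> = (\<Sum>k. \<integral>\<^sup>+u. ennreal (c k) * (ennreal (radius k u) * avg k (\<lambda>v. ennreal (g u v)) u) \<partial>m)"
    using c_pos radius_nonneg by (simp add: ennreal_mult mult.assoc less_imp_le)
  also have "\<dots> = (\<Sum>k. ennreal (c k) * (\<integral>\<^sup>+u. ennreal (radius k u) * avg k (\<lambda>v. ennreal (g u v)) u \<partial>m))"
    unfolding avg_def by (intro suminf_cong nn_integral_cmult) measurable
  finally show ?thesis .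
qed

lemma mass_eq: "mass = (\<integral>\<^sup>+u. (\<Sum>k. ennreal (c k * radius k u)) \<partial>m)"
proof -
  have "mass = (\<Sum>k. ennreal (c k) * (\<integral>\<^sup>+u. ennreal (radius k u) \<partial>m))"
    using nn_integral_weight_mult[of "\<lambda>_ _. 1"] by (simp add: mass_def avg_const case_prod_beta')
  also have "\<dots> = (\<Sum>k. \<integral>\<^sup>+u. ennreal (c k * radius k u) \<partial>m)"
    using c_pos radius_nonneg
    by (simp add: ennreal_mult less_imp_le nn_integral_cmult)
  also have "\<dots> = (\<integral>\<^sup>+u. (\<Sum>k. ennreal (c k * radius k u)) \<partial>m)"
    by (intro nn_integral_suminf[symmetric]) measurable
  finally show ?thesis .
qed

text \<open>The pointwise comparison with \<open>maj_sigma\<close> is integrated. This contributes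
  the remaining factor \<open>R / (R - 1)\<close> of \<open>B\<close>.\<close>

lemma mass_le: "mass \<le> ennreal (R / (R - 1)) * maj_S m \<phi>"
proof -
  have one: "ennreal (R / (R - 1)) * ennreal ((R - 1) / R) = 1"
    using R_ge by (simp flip: ennreal_mult)
  have "ennreal ((R - 1) / R) * mass = (\<integral>\<^sup>+u. ennreal ((R - 1) / R) * (\<Sum>k. ennreal (c k * radius k u)) \<partial>m)"
    unfolding mass_eq by (intro nn_integral_cmult[symmetric]) measurable
  also have "\<dots> \<le> maj_S m \<phi>"
    unfolding maj_S_def
  proof (intro nn_integral_mono)
    fix u
    have "(\<Sum>k<n. ennreal (c k * radius k u)) \<le> ennreal (R / (R - 1)) * maj_sigma m \<phi> u" for n
      by (rule order_trans[OF sum_mono2 sum_c_radius_le_sigma[of _ n]]) auto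
    then have "(\<Sum>k. ennreal (c k * radius k u)) \<le> ennreal (R / (R - 1)) * maj_sigma m \<phi> u"
      by (intro suminf_le_const summableI)
    then have "ennreal ((R - 1) / R) * (\<Sum>k. ennreal (c k * radius k u))
        \<le> ennreal ((R - 1) / R) * (ennreal (R / (R - 1)) * maj_sigma m \<phi> u)"
      by (rule mult_left_mono) simp
    also have "\<dots> = maj_sigma m \<phi> u"
      using one by (simp add: mult.commute[of "ennreal ((R - 1) / R)"] flip: mult.assoc)
    finally show "ennreal ((R - 1) / R) * (\<Sum>k. ennreal (c k * radius k u)) \<le> maj_sigma m \<phi> u" .
  qed
  finally have "ennreal (R / (R - 1)) * (ennreal ((R - 1) / R) * mass) \<le> ennreal (R / (R - 1)) * maj_S m \<phi>"
    by (rule mult_left_mono) simp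
  then show ?thesis using one by (simp flip: mult.assoc)
qed

section \<open>Positivity on spaces with more than one point\<close>

lemma radius_0_pos:
  assumes "x \<noteq> (y::'a)"
  shows "0 < radius 0 z"
proof (rule ccontr)
  assume "\<not> 0 < radius 0 z"
  then have "radius 0 z = 0" using radius_nonneg[of 0 z] by linarith
  then have p: "prob {z} = 1"
    using prob_cball_radius[of 0 z] prob_le_1[of "{z}"] by (simp add: phi_c_0)
  \<comment> \<open>A ball around a second point that misses \<open>z\<close> has positive measure,
    so \<open>z\<close> cannot carry all the mass.\<close>
  obtain w where w: "w \<noteq> z" using assms by metis
  have "prob ({z} \<union> ball w (dist w z)) = prob {z} + prob (ball w (dist w z))"
    by (intro finite_measure_Union) (auto simp: sets_m)
  moreover have "prob ({z} \<union> ball w (dist w z)) \<le> 1" by (rule prob_le_1)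
  ultimately show False using p prob_ball_pos[of "dist w z" w] w by simp
qed

lemma sigma_pos:
  assumes "x \<noteq> (y::'a)"
  shows "0 < maj_sigma m \<phi> t"
proof (rule ccontr)
  assume "\<not> 0 < maj_sigma m \<phi> t"
  then have "c 0 * radius 0 t \<le> 0" using sum_c_radius_le_sigma[of t 0] by (simp add: ennreal_eq_0_iff)
  then show False using radius_0_pos[OF assms, of t] c_pos[of 0] by (simp add: mult_le_0_iff)
qed

lemma mass_pos:
  assumes "x \<noteq> (y::'a)"
  shows "0 < mass"
proof (rule ccontr)
  assume "\<not> 0 < mass"
  then have "mass = 0" by simp
  then have "AE u in m. (\<Sum>k. ennreal (c k * radius k u)) = 0"
    unfolding mass_eq by (subst (asm) nn_integral_0_iff_AE) measurable
  then obtain u where "(\<Sum>k. ennreal (c k * radius k u)) = 0"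
    using eventually_happens'[OF ae_filter_bot] by blast
  then have "ennreal (c 0 * radius 0 u) = 0"
    using sum_le_suminf_ennreal[of "\<lambda>k. ennreal (c k * radius k u)" 0] by simp
  then show False using radius_0_pos[OF assms, of u] c_pos[of 0]
    by (simp add: ennreal_eq_0_iff mult_le_0_iff)
qed

lemma err_le_sigma:
  assumes "x \<noteq> (y::'a)"
    and A: "A = (if R = 2 then \<infinity> else ennreal (R ^ 3 / ((R - 1) * (R - 2))))"
  shows "ennreal (a * err n t) \<le> ennreal a * A * maj_sigma m \<phi> t"
proof (cases "a = 0 \<or> R = 2")
  \<comment> \<open>For \<open>a = 0\<close> the left-hand side vanishes. For \<open>a > 0\<close>
    and \<open>R = 2\<close> the right-hand side is infinite, since positivity of
    \<open>maj_sigma\<close> rules out the product of infinity and 0.\<close>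
  case True
  then show ?thesis
    using a_nonneg sigma_pos[OF assms(1), of t] A
    by (cases "a = 0") (auto simp: ennreal_mult_top ennreal_top_mult ennreal_mult_eq_top_iff zero_less_iff_neq_zero)
next
  case False
  then have R: "2 < R" using R_ge by simp
  have nn: "0 \<le> c k * radius k t" for k
    using c_pos[of k] radius_nonneg[of k t] by simp
  let ?S = "\<Sum>k\<le>n. c k * radius k t"
  have S: "0 \<le> ?S" by (intro sum_nonneg nn)
  \<comment> \<open>The estimates so far give the factor \<open>R^2 / (R - 2)\<close>; the constant
    \<open>A\<close> is larger by \<open>R / (R - 1)\<close>.\<close>
  have "R * R / (R - 2) * 1 \<le> R * R / (R - 2) * (R / (R - 1))"
    using R by (intro mult_left_mono) auto
  then have A_ge: "R * (R - 1) / (R - 2) * (R / (R - 1)) \<le> R ^ 3 / ((R - 1) * (R - 2))"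
    using R by (simp add: power3_eq_cube mult_ac)
  have "ennreal (a * err n t) \<le> ennreal (a * (R * (R - 1) / (R - 2) * ?S))"
    by (intro ennreal_leI mult_left_mono err_le R a_nonneg)
  also have "\<dots> = ennreal a * (ennreal (R * (R - 1) / (R - 2)) * ennreal ?S)"
    using a_nonneg R S by (subst ennreal_mult, simp, simp, subst ennreal_mult) simp_all
  also have "ennreal ?S = (\<Sum>k\<le>n. ennreal (c k * radius k t))"
    by (rule sum_ennreal[symmetric]) (rule nn)
  also have "ennreal a * (ennreal (R * (R - 1) / (R - 2)) * (\<Sum>k\<le>n. ennreal (c k * radius k t)))
      \<le> ennreal a * (ennreal (R * (R - 1) / (R - 2)) * (ennreal (R / (R - 1)) * maj_sigma m \<phi> t))"
    by (intro mult_left_mono sum_c_radius_le_sigma) auto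
  also have "\<dots> = ennreal a * (ennreal (R * (R - 1) / (R - 2) * (R / (R - 1))) * maj_sigma m \<phi> t)"
    using R by (subst ennreal_mult[of "R * (R - 1) / (R - 2)"]) (auto simp: mult.assoc)
  also have "\<dots> \<le> ennreal a * (ennreal (R ^ 3 / ((R - 1) * (R - 2))) * maj_sigma m \<phi> t)"
    by (intro mult_left_mono mult_right_mono ennreal_leI A_ge) auto
  finally show ?thesis using R A by (simp add: mult.assoc)
qed

text \<open>Multiplying the integral against the normalised weight by \<open>mass\<close> gives back
  the sum of energies in \<open>deviation_bound\<close>, and \<open>mass_le\<close> then replaces
  \<open>mass\<close> by \<open>maj_S\<close>. The normalisation works because \<open>mass\<close>
  is finite when \<open>maj_S\<close> is and positive when there are two points.\<close>

lemma exists_measure_if_finite: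
  assumes ne: "x \<noteq> (y::'a)" and fin: "maj_S m \<phi> < \<top>"
    and A: "A = (if R = 2 then \<infinity> else ennreal (R ^ 3 / ((R - 1) * (R - 2))))"
  shows "\<exists>\<nu> :: ('a \<times> 'a) measure. prob_space \<nu> \<and> sets \<nu> = sets borel \<and>
    (\<forall>f :: 'a \<Rightarrow> real. continuous_on UNIV f \<longrightarrow> bounded (range f) \<longrightarrow>
      (\<forall>t. ennreal \<bar>f t - (\<integral>u. f u \<partial>m)\<bar>
          \<le> ennreal a * A * maj_sigma m \<phi> t
            + ennreal b * ennreal (R ^ 2 / (R - 1)) * maj_S m \<phi> *
              (\<integral>\<^sup>+(u, v). ennreal (slope f u v) \<partial>\<nu>)))"
proof (intro exI conjI allI impI)
  let ?\<nu> = "density (m \<Otimes>\<^sub>M m) (\<lambda>z. weight z / mass)"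
  have mass_fin: "mass < \<top>"
    using fin by (intro le_less_trans[OF mass_le]) (simp add: ennreal_mult_less_top)
  have mass_div: "mass * (z / mass) = z" for z
    using mass_fin mass_pos[OF ne]
    by (metis ennreal_mult_divide_eq ennreal_times_divide less_irrefl mult.commute)
  show "prob_space ?\<nu>"
  proof
    have "emeasure ?\<nu> (space ?\<nu>) = (\<integral>\<^sup>+z. weight z / mass \<partial>(m \<Otimes>\<^sub>M m))"
      by (simp add: emeasure_density cong: nn_integral_cong)
    also have "\<dots> = mass / mass"
      by (simp add: nn_integral_divide mass_def)
    also have "\<dots> = 1"
      using mass_fin mass_pos[OF ne] by (intro ennreal_divide_self) auto
    finally show "emeasure ?\<nu> (space ?\<nu>) = 1" .
  qed
  show "sets ?\<nu> = sets borel" by (simp add: sets_pair_m)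
  fix f :: "'a \<Rightarrow> real" and t
  assume f: "continuous_on UNIV f" and bdd: "bounded (range f)"
  note [measurable] = slope_measurable[OF f]
  let ?I = "\<integral>\<^sup>+(u, v). ennreal (slope f u v) \<partial>?\<nu>"
  have "?I = (\<integral>\<^sup>+z. weight z / mass * ennreal (case_prod (slope f) z) \<partial>(m \<Otimes>\<^sub>M m))"
    by (subst nn_integral_density) (auto simp: case_prod_beta')
  also have "\<dots> = (\<integral>\<^sup>+z. weight z * ennreal (case_prod (slope f) z) \<partial>(m \<Otimes>\<^sub>M m)) / mass"
    by (subst nn_integral_divide[symmetric]) (auto simp: divide_ennreal_def mult_ac)
  finally have "mass * ?I = (\<Sum>k. ennreal (c k) * slope_energy f k)"
    using nn_integral_weight_mult[OF slope_measurable[OF f]] mass_div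
    by (simp add: slope_energy_def slope_mean_def)
  then have "ennreal \<bar>f t - (\<integral>u. f u \<partial>m)\<bar>
      \<le> ennreal a * A * maj_sigma m \<phi> t + ennreal (b * R) * (mass * ?I)"
    using deviation_bound[OF f bdd err_le_sigma[OF ne A]] by simp
  also have "ennreal (b * R) * (mass * ?I)
      \<le> ennreal (b * R) * (ennreal (R / (R - 1)) * maj_S m \<phi> * ?I)"
    by (intro mult_left_mono mult_right_mono mass_le) auto
  also have "\<dots> = ennreal (b * R) * ennreal (R / (R - 1)) * maj_S m \<phi> * ?I"
    by (simp add: mult.assoc)
  also have "ennreal (b * R) * ennreal (R / (R - 1)) = ennreal b * ennreal (R ^ 2 / (R - 1))"
    using R_ge b_nonneg by (simp add: power2_eq_square mult.assoc flip: ennreal_mult)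
  finally show "ennreal \<bar>f t - (\<integral>u. f u \<partial>m)\<bar> \<le> ennreal a * A * maj_sigma m \<phi> t
      + ennreal b * ennreal (R ^ 2 / (R - 1)) * maj_S m \<phi> * ?I"
    by (simp add: add_left_mono)
qed

end

text \<open>Ball measures are at most 1, so the integrand of \<open>maj_sigma\<close> is at least
  the positive number \<open>half_inv \<phi> 1\<close>, here over an infinite range.\<close>

lemma (in majorizing_measure) maj_S_infinite_if_unbounded:
  assumes D: "ediam (UNIV :: 'a set) = \<top>"
  shows "maj_S m \<phi> = \<top>"
proof -
  have "maj_sigma m \<phi> x = \<top>" for x
  proof -
    have "\<top> = (\<integral>\<^sup>+e. ennreal (half_inv \<phi> 1) * indicator {0<..} e \<partial>(lborel :: real measure))"
      using half_inv_1_pos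
      by (simp add: nn_integral_cmult_indicator emeasure_lborel_Ioi ennreal_mult_top)
    also have "\<dots> \<le> maj_sigma m \<phi> x"
      unfolding maj_sigma_def D
    proof (intro nn_integral_mono)
      fix e :: real
      have "half_inv \<phi> 1 \<le> half_inv \<phi> (1 / prob (cball x e))" if "0 < e"
        using prob_cball_pos[OF that, of x] half_inv_1_pos
        by (intro le_half_inv) (auto simp: phi_half_inv)
      then show "ennreal (half_inv \<phi> 1) * indicator {0<..} e
          \<le> ennreal (half_inv \<phi> (1 / prob (cball x e))) * indicator {e. 0 < e \<and> ennreal e < \<top>} e"
        by (auto simp: indicator_def intro: ennreal_leI)
    qed
    finally show ?thesis by (simp add: top_unique)
  qed
  then show ?thesis using emeasure_space_1 by (simp add: maj_S_def)
qed

theorem theorem1p2: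
  fixes m :: "'a::metric_space measure"
    and a b R :: real
    and \<phi> :: "real \<Rightarrow> real"
    and A B :: ennreal
  assumes "prob_space m" and "sets m = sets borel" and "measure_support m = UNIV"
    and "a \<ge> 0" and "b \<ge> 0" and "\<phi> \<in> growth_class a b" and "R \<ge> 2"
    and "A = (if R = 2 then \<infinity> else ennreal (R ^ 3 / ((R - 1) * (R - 2))))"
    and "B = ennreal (R ^ 2 / (R - 1))"
  shows "\<exists>\<nu> :: ('a \<times> 'a) measure. prob_space \<nu> \<and> sets \<nu> = sets borel \<and>
    (\<forall>f :: 'a \<Rightarrow> real. continuous_on UNIV f \<longrightarrow> bounded (range f) \<longrightarrow>
      (\<forall>t. ennreal \<bar>f t - (\<integral>u. f u \<partial>m)\<bar>
          \<le> ennreal a * A * maj_sigma m \<phi> t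
            + ennreal b * B * maj_S m \<phi> *
              (\<integral>\<^sup>+(u, v). ennreal (\<phi> (\<bar>f u - f v\<bar> / dist u v)) \<partial>\<nu>)))"
proof -
  interpret majorizing_measure m \<phi> a b R
    using assms by (intro majorizing_measure.intro majorizing_measure_axioms.intro) auto
  show ?thesis
  proof (cases "maj_S m \<phi> < \<top> \<and> (\<exists>x y :: 'a. x \<noteq> y)")
    case True
    then have "ediam (UNIV :: 'a set) < \<top>"
      using maj_S_infinite_if_unbounded by (metis less_top)
    then interpret bounded_majorizing_measure m \<phi> a b R by unfold_locales
    from True obtain x y :: 'a where "x \<noteq> y" "maj_S m \<phi> < \<top>" by blast
    from exists_measure_if_finite[OF this assms(8)] show ?thesis
      unfolding assms(9) slope_def .
  next
    case False
    \<comment> \<open>Here the product measure serves. If its slope integral is 0, then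
      \<open>f\<close> equals its mean; otherwise the space has two points, as all slopes vanish on
      a single point, so \<open>maj_S\<close> is infinite and so is the right-hand side.\<close>
    interpret pair_prob_space m m ..
    show ?thesis
    proof (intro exI conjI allI impI)
      show "prob_space (m \<Otimes>\<^sub>M m)" by (rule prob_space_axioms)
      show "sets (m \<Otimes>\<^sub>M m) = sets borel" by (rule sets_pair_m)
      fix f :: "'a \<Rightarrow> real" and t
      assume f: "continuous_on UNIV f"
      let ?I = "\<integral>\<^sup>+(u, v). ennreal (\<phi> (\<bar>f u - f v\<bar> / dist u v)) \<partial>(m \<Otimes>\<^sub>M m)"
      show "ennreal \<bar>f t - (\<integral>u. f u \<partial>m)\<bar>
          \<le> ennreal a * A * maj_sigma m \<phi> t + ennreal b * B * maj_S m \<phi> * ?I"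
      proof (cases "?I = 0")
        case True
        then show ?thesis
          using eq_integral_if_slope_vanishes[OF f, of t] by (simp add: slope_def)
      next
        case I: False
        have "maj_S m \<phi> = \<top>"
        proof (rule ccontr)
          assume "maj_S m \<phi> \<noteq> \<top>"
          with False have "\<phi> (\<bar>f u - f v\<bar> / dist u v) = 0" for u v
            using phi_0 by (auto simp: less_top) (metis dist_self div_by_0 phi_0)
          with I show False by (simp add: case_prod_beta')
        qed
        moreover have "ennreal b * B \<noteq> 0"
          using b_pos assms(7,9) by (simp add: ennreal_eq_0_iff divide_le_0_iff)
        ultimately have "ennreal b * B * maj_S m \<phi> * ?I = \<top>"
          using I by (simp add: ennreal_mult_eq_top_iff)
        then show ?thesis by simp
      qed
    qed
  qed
qed

end
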